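(* Let $R$ be a finite ring (associative, with nonzero identity), and let $J(R)$ denote its Jacobson radical. Then the unit graph $\Gamma'(R)$ of $R$ is well-covered if and only if the unitary Cayley graph $\Gamma(R)$ of $R$ is well-covered and $\operatorname{char}(R/J(R))=2$.
   Context: All rings are finite, associative, with nonzero identity; $U(R)$ is the set of units of $R$. The unit graph $\Gamma'(R)$ has vertex set $R$, two distinct vertices $x,y$ adjacent iff $x+y\in U(R)$. The unitary Cayley graph $\Gamma(R)$ has vertex set $R$, two distinct vertices $x,y$ adjacent iff $x-y\in U(R)$. A graph is well-covered if all its maximal independent sets have the same size. *)

theory Defs
  imports "HOL-Algebra.QuotRing" "Graph_Theory.Pair_Digraph"
begin

text \<open>A simple undirected graph is represented by a \<^locale>\<open>pair_graph\<close>, that is, with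
  the symmetric irreflexive set of arcs which has both orientations of every edge.\<close>

definition independent_set :: "'a pair_pre_digraph \<Rightarrow> 'a set \<Rightarrow> bool" where
  "independent_set G S \<longleftrightarrow> S \<subseteq> pverts G \<and> (\<forall>u\<in>S. \<forall>v\<in>S. (u, v) \<notin> parcs G)"

definition maximal_independent_set :: "'a pair_pre_digraph \<Rightarrow> 'a set \<Rightarrow> bool" where
  "maximal_independent_set G S \<longleftrightarrow>
     independent_set G S \<and> (\<forall>T. independent_set G T \<and> S \<subseteq> T \<longrightarrow> T = S)"

definition well_covered :: "'a pair_pre_digraph \<Rightarrow> bool" where
  "well_covered G \<longleftrightarrow>
     (\<forall>S T. maximal_independent_set G S \<and> maximal_independent_set G T \<longrightarrow> card S = card T)"

definition unit_graph :: "('a, 'm) ring_scheme \<Rightarrow> 'a pair_pre_digraph" where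
  "unit_graph R = \<lparr> pverts = carrier R,
     parcs = {(x, y). x \<in> carrier R \<and> y \<in> carrier R \<and> x \<noteq> y \<and> x \<oplus>\<^bsub>R\<^esub> y \<in> Units R} \<rparr>"

definition unitary_cayley_graph :: "('a, 'm) ring_scheme \<Rightarrow> 'a pair_pre_digraph" where
  "unitary_cayley_graph R = \<lparr> pverts = carrier R,
     parcs = {(x, y). x \<in> carrier R \<and> y \<in> carrier R \<and> x \<noteq> y \<and> x \<ominus>\<^bsub>R\<^esub> y \<in> Units R} \<rparr>"

lemma finite_parcs_in_carrier:
  assumes "finite A" shows "finite {(x, y). x \<in> A \<and> y \<in> A \<and> P x y}"
  by (rule finite_subset[of _ "A \<times> A"]) (use assms in auto)

lemma pair_graph_unit_graph:
  fixes R (structure)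
  assumes "ring R" "finite (carrier R)"
  shows "pair_graph (unit_graph R)"
proof -
  interpret ring R by fact
  show ?thesis
    by unfold_locales
       (use assms(2) in \<open>auto simp: symmetric_def unit_graph_def a_comm finite_parcs_in_carrier
          intro!: symI\<close>)
qed

lemma pair_graph_unitary_cayley_graph:
  fixes R (structure)
  assumes "ring R" "finite (carrier R)"
  shows "pair_graph (unitary_cayley_graph R)"
proof -
  interpret ring R by fact
  have swap: "y \<ominus> x \<in> Units R"
    if "x \<in> carrier R" "y \<in> carrier R" "x \<ominus> y \<in> Units R" for x y
  proof -
    have "\<ominus> (x \<ominus> y) = y \<ominus> x"
      using that by (simp add: a_minus_def minus_add a_comm)
    moreover have "\<ominus> u \<in> Units R" if "u \<in> Units R" for u
    proof -
      have u: "u \<in> carrier R" "inv u \<in> carrier R" "inv u \<otimes> u = \<one>" "u \<otimes> inv u = \<one>"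
        using that by (simp_all add: Units_closed)
      have "\<ominus> (inv u) \<otimes> \<ominus> u = \<one>" "\<ominus> u \<otimes> \<ominus> (inv u) = \<one>"
        using u by (simp_all add: l_minus r_minus)
      then show ?thesis
        unfolding Units_def using u by blast
    qed
    ultimately show ?thesis using that by metis
  qed
  show ?thesis
    by unfold_locales
       (use assms(2) swap in \<open>auto simp: symmetric_def unitary_cayley_graph_def finite_parcs_in_carrier
          intro!: symI\<close>)
qed

text \<open>The library locale \<^locale>\<open>ideal\<close> is two-sided, so left ideals are introduced here.\<close>

definition left_ideal :: "'a set \<Rightarrow> ('a, 'm) ring_scheme \<Rightarrow> bool" where
  "left_ideal I R \<longleftrightarrow>
     subgroup I (add_monoid R) \<and> (\<forall>a\<in>carrier R. \<forall>x\<in>I. a \<otimes>\<^bsub>R\<^esub> x \<in> I)"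

definition maximal_left_ideal :: "'a set \<Rightarrow> ('a, 'm) ring_scheme \<Rightarrow> bool" where
  "maximal_left_ideal I R \<longleftrightarrow>
     left_ideal I R \<and> I \<noteq> carrier R \<and>
     (\<forall>K. left_ideal K R \<and> I \<subseteq> K \<longrightarrow> K = I \<or> K = carrier R)"

definition jacobson_radical :: "('a, 'm) ring_scheme \<Rightarrow> 'a set" where
  "jacobson_radical R = carrier R \<inter> \<Inter> {I. maximal_left_ideal I R}"

definition ring_characteristic :: "('a, 'm) ring_scheme \<Rightarrow> nat" where
  "ring_characteristic R =
     (if \<exists>n::nat. n > 0 \<and> [n] \<cdot>\<^bsub>R\<^esub> \<one>\<^bsub>R\<^esub> = \<zero>\<^bsub>R\<^esub>
      then LEAST n::nat. n > 0 \<and> [n] \<cdot>\<^bsub>R\<^esub> \<one>\<^bsub>R\<^esub> = \<zero>\<^bsub>R\<^esub>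
      else 0)"

end

theory Submission
  imports Defs "HOL-Algebra.Sylow" "HOL-Algebra.Multiplicative_Group"
begin

text \<open>
  Some power \<open>h = 2^n\<close> with \<open>n > 0\<close> is a central idempotent, and \<open>2\<close> lies in \<open>J(R)\<close> iff \<open>h = 0\<close>. In that
  case adding \<open>2y\<close> preserves units, so the two graphs coincide. It remains to show that a well-covered
  unit graph forces \<open>h = 0\<close>.

  For an idempotent \<open>e\<close> with local corner ring \<open>eRe\<close>, the maximal left ideal
  \<open>M\<^sub>e = {x. eRxe consists of non-units of eRe}\<close> is a maximal independent set, and its index is odd
  if \<open>he = e\<close> and even if \<open>he = 0\<close>. If \<open>h\<close> is neither 0 nor 1, both kinds of \<open>e\<close> exist and give
  maximal independent sets of different sizes. If \<open>h = 1\<close>, then \<open>2\<close> is a unit, so \<open>|R|\<close> and \<open>|M\<^sub>e|\<close> are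
  odd, whereas the signed sums \<open>\<plusminus>e\<^sub>1 \<plusminus> \<dots> \<plusminus> e\<^sub>k\<close> over a complete orthogonal family of local
  idempotents form a maximal independent set of size \<open>2^k\<close>.
\<close>

section \<open>Units and corner rings of finite rings\<close>

text \<open>This is the corner ring eRe. Two fixed-point equations describe its elements instead of
  the form \<open>e r e\<close>, so that membership is settled by rewriting; keeping the operations
  of \<open>R\<close> lets computations pass between \<open>R\<close> and the corner
  unchanged.\<close>

definition corner :: "('a, 'm) ring_scheme \<Rightarrow> 'a \<Rightarrow> ('a, 'm) ring_scheme" where
  "corner R e = R\<lparr>carrier := {x \<in> carrier R. e \<otimes>\<^bsub>R\<^esub> x = x \<and> x \<otimes>\<^bsub>R\<^esub> e = x}, one := e\<rparr>"

lemma corner_simps [simp]: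
  "carrier (corner R e) = {x \<in> carrier R. e \<otimes>\<^bsub>R\<^esub> x = x \<and> x \<otimes>\<^bsub>R\<^esub> e = x}"
  "monoid.mult (corner R e) = monoid.mult R" "monoid.one (corner R e) = e"
  "ring.add (corner R e) = ring.add R" "ring.zero (corner R e) = ring.zero R"
  by (simp_all add: corner_def)

context ring
begin

text \<open>Pigeonhole turns the trivial kernel into bijectivity of left multiplication by
  \<open>b\<close>, which gives a right inverse \<open>y\<close>; as \<open>b\<close> kills
  \<open>y b - 1\<close>, it is also a left inverse. This unit test reduces the block matrix
  arguments below to elimination.\<close>

lemma Units_if_no_right_annihilator:
  assumes "finite (carrier R)" "b \<in> carrier R"
    and ann: "\<And>z. z \<in> carrier R \<Longrightarrow> b \<otimes> z = \<zero> \<Longrightarrow> z = \<zero>"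
  shows "b \<in> Units R"
proof -
  have "inj_on ((\<otimes>) b) (carrier R)"
  proof (rule inj_onI)
    fix x y assume xy: "x \<in> carrier R" "y \<in> carrier R" "b \<otimes> x = b \<otimes> y"
    then have "b \<otimes> (x \<ominus> y) = \<zero>"
      using assms(2) by (simp add: a_minus_def r_distr r_minus r_neg)
    then show "x = y"
      using ann[of "x \<ominus> y"] xy by simp
  qed
  then have "(\<otimes>) b ` carrier R = carrier R"
    using assms(1,2) by (intro endo_inj_surj) auto
  then obtain y where y: "y \<in> carrier R" "b \<otimes> y = \<one>"
    by (metis imageE one_closed)
  have "b \<otimes> (y \<otimes> b \<ominus> \<one>) = b \<otimes> y \<otimes> b \<ominus> b"
    using y(1) assms(2) by (simp add: a_minus_def r_distr r_minus m_assoc)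
  also have "\<dots> = \<zero>"
    using y assms(2) by (simp add: a_minus_def r_neg)
  finally have "y \<otimes> b = \<one>"
    using ann[of "y \<otimes> b \<ominus> \<one>"] y(1) assms(2) by simp
  then show ?thesis
    using y assms(2) unfolding Units_def by blast
qed

text \<open>The powers of \<open>a\<close> become periodic, from exponent \<open>i\<close> on with
  period \<open>p\<close>. The exponent \<open>i * p\<close> is a multiple of the period and at
  least \<open>i\<close>, so doubling it does not change the power.\<close>

lemma idempotent_power_exists:
  assumes "finite (carrier R)" "a \<in> carrier R"
  shows "\<exists>n::nat. 0 < n \<and> a [^] n \<otimes> a [^] n = a [^] n"
proof -
  have "\<not> inj_on (\<lambda>n::nat. a [^] n) {1..}"
  proof
    assume "inj_on (\<lambda>n::nat. a [^] n) {1..}"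
    moreover have "finite ((\<lambda>n::nat. a [^] n) ` {1..})"
      using assms by (auto intro: finite_subset[of _ "carrier R"])
    ultimately show False
      using finite_imageD infinite_Ici by blast
  qed
  then obtain i j :: nat where "1 \<le> i" "i < j" "a [^] i = a [^] j"
    unfolding inj_on_def by (metis atLeast_iff linorder_neqE_nat)
  then obtain p where p: "0 < p" "1 \<le> i" "a [^] i = a [^] (i + p)"
    by (metis less_imp_add_positive)
  have step: "a [^] (m + p) = a [^] m" if im: "i \<le> m" for m :: nat
  proof -
    obtain k where "m = i + k" using im by (auto simp: le_iff_add)
    then have "a [^] (m + p) = a [^] (i + p) \<otimes> a [^] k"
      using assms(2) by (simp add: nat_pow_mult add.commute add.left_commute)
    also have "\<dots> = a [^] i \<otimes> a [^] k"
      using p(3) by simp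
    finally show ?thesis
      using \<open>m = i + k\<close> assms(2) by (simp add: nat_pow_mult)
  qed
  have "a [^] (i * p + k * p) = a [^] (i * p)" for k
  proof (induction k)
    case (Suc k)
    have "i \<le> i * p + k * p" using p(1) by (cases p) auto
    then show ?case
      using step[of "i * p + k * p"] Suc by (simp add: add.commute add.left_commute)
  qed simp
  from this[of i] show ?thesis
    using p(1,2) assms(2) by (intro exI[of _ "i * p"]) (simp add: nat_pow_mult)
qed

lemma Units_power_one:
  assumes "a \<in> carrier R" "a [^] (n::nat) = \<one>" "0 < n"
  shows "a \<in> Units R"
proof -
  obtain k where n: "n = Suc k" using assms(3) by (metis gr0_implies_Suc)
  have "a \<otimes> a [^] k = \<one>" "a [^] k \<otimes> a = \<one>"
    using assms(1,2) n by (simp_all add: nat_pow_Suc2[symmetric])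
  then show ?thesis
    using assms(1) unfolding Units_def by blast
qed

lemma zero_if_fixed_by_nilpotent:
  assumes "a \<in> carrier R" "z \<in> carrier R" "a \<otimes> z = z" "a [^] (n::nat) = \<zero>"
  shows "z = \<zero>"
proof -
  have "a [^] k \<otimes> z = z" for k :: nat
    by (induction k) (use assms in \<open>simp_all add: m_assoc\<close>)
  from this[of n] show ?thesis
    using assms by simp
qed

text \<open>Some power of \<open>a\<close> is 0 or 1. If it is 1, \<open>a\<close> is a unit; if it
  is 0, \<open>(1 - a) z = 0\<close> means \<open>z = a z\<close>, and nilpotency of
  \<open>a\<close> forces \<open>z = 0\<close>.\<close>

lemma local_if_trivial_idempotents:
  assumes "finite (carrier R)" "a \<in> carrier R"
    and idem: "\<And>x. x \<in> carrier R \<Longrightarrow> x \<otimes> x = x \<Longrightarrow> x = \<zero> \<or> x = \<one>"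
  shows "a \<in> Units R \<or> \<one> \<ominus> a \<in> Units R"
proof -
  obtain n :: nat where n: "0 < n" "a [^] n \<otimes> a [^] n = a [^] n"
    using idempotent_power_exists assms by blast
  then consider "a [^] n = \<zero>" | "a [^] n = \<one>"
    using idem[of "a [^] n"] assms by auto
  then show ?thesis
  proof cases
    case 1
    have "\<one> \<ominus> a \<in> Units R"
    proof (rule Units_if_no_right_annihilator)
      fix z assume z: "z \<in> carrier R" "(\<one> \<ominus> a) \<otimes> z = \<zero>"
      then have "z \<ominus> a \<otimes> z = \<zero>"
        using assms by (simp add: a_minus_def l_distr l_minus)
      then show "z = \<zero>"
        using zero_if_fixed_by_nilpotent[OF assms(2) z(1) _ 1] assms(2) z(1) by simp
    qed (use assms in auto)
    then show ?thesis ..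
  next
    case 2
    then show ?thesis using Units_power_one n assms by blast
  qed
qed

lemma Units_minus:
  assumes "u \<in> Units R"
  shows "\<ominus> u \<in> Units R"
proof -
  have u: "u \<in> carrier R" "inv u \<in> carrier R" "inv u \<otimes> u = \<one>" "u \<otimes> inv u = \<one>"
    using assms by (simp_all add: Units_closed)
  have "\<ominus> (inv u) \<otimes> \<ominus> u = \<one>" "\<ominus> u \<otimes> \<ominus> (inv u) = \<one>"
    using u by (simp_all add: l_minus r_minus)
  then show ?thesis
    unfolding Units_def using u by blast
qed

section \<open>The ring structure of a corner\<close>

lemma ring_corner:
  assumes "e \<in> carrier R" "e \<otimes> e = e"
  shows "ring (corner R e)"
proof (rule ringI)
  show "abelian_group (corner R e)"
  proof (rule abelian_groupI)
    fix x assume x: "x \<in> carrier (corner R e)"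
    show "\<exists>y\<in>carrier (corner R e). y \<oplus>\<^bsub>corner R e\<^esub> x = \<zero>\<^bsub>corner R e\<^esub>"
      by (rule bexI[of _ "\<ominus> x"]) (use assms x in \<open>auto simp: l_neg l_minus r_minus\<close>)
  qed (use assms in \<open>auto simp: l_distr r_distr a_ac\<close>)
  show "monoid (corner R e)"
    by (rule monoidI) (use assms in \<open>auto simp: m_assoc\<close>, metis m_assoc)
qed (use assms in \<open>auto simp: l_distr r_distr\<close>)

text \<open>Negation is computed from the carrier rather than stored as a record field, so a smaller
  carrier could change it; uniqueness of inverses shows that it does not.\<close>

lemma a_inv_corner [simp]:
  assumes "e \<in> carrier R" "e \<otimes> e = e" "x \<in> carrier (corner R e)"
  shows "\<ominus>\<^bsub>corner R e\<^esub> x = \<ominus> x"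
proof -
  interpret C: ring "corner R e" using ring_corner assms by blast
  have "\<ominus> x \<in> carrier (corner R e)" "\<ominus> x \<oplus>\<^bsub>corner R e\<^esub> x = \<zero>\<^bsub>corner R e\<^esub>"
    using assms by (auto simp: l_neg l_minus r_minus)
  then show ?thesis
    using assms(3) C.minus_equality by blast
qed

lemma a_minus_corner [simp]:
  assumes "e \<in> carrier R" "e \<otimes> e = e" "y \<in> carrier (corner R e)"
  shows "x \<ominus>\<^bsub>corner R e\<^esub> y = x \<ominus> y"
  by (simp only: a_minus_def a_inv_corner[OF assms] corner_simps)

end

section \<open>Left ideals attached to local idempotents\<close>

text \<open>The last clause says that eRe is a local ring, in a form that refers to units
  only.\<close>

definition local_idempotent :: "('a, 'm) ring_scheme \<Rightarrow> 'a \<Rightarrow> bool" where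
  "local_idempotent R e \<longleftrightarrow> e \<in> carrier R \<and> e \<otimes>\<^bsub>R\<^esub> e = e \<and> e \<noteq> \<zero>\<^bsub>R\<^esub> \<and>
     (\<forall>a\<in>carrier (corner R e). a \<in> Units (corner R e) \<or> e \<ominus>\<^bsub>R\<^esub> a \<in> Units (corner R e))"

text \<open>For a local idempotent \<open>e\<close> this is the kernel of the map from
  \<open>R\<close> to the simple module Re/Je, with J the radical, that sends \<open>x\<close> to
  the class of \<open>x e\<close>. Testing units of eRe avoids both modules and J.\<close>

definition local_left_ideal :: "('a, 'm) ring_scheme \<Rightarrow> 'a \<Rightarrow> 'a set" where
  "local_left_ideal R e = {x \<in> carrier R. \<forall>r\<in>carrier R.
     e \<otimes>\<^bsub>R\<^esub> r \<otimes>\<^bsub>R\<^esub> x \<otimes>\<^bsub>R\<^esub> e \<notin> Units (corner R e)}"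

context ring
begin

text \<open>The inverse \<open>u\<close> of \<open>x + y\<close> normalises the sum to
  \<open>u x + u y = 1\<close>; locality applies to \<open>u x\<close>, and the factor
  \<open>u\<close> is cancelled afterwards.\<close>

lemma local_add_Units:
  assumes loc: "\<And>a. a \<in> carrier R \<Longrightarrow> a \<in> Units R \<or> \<one> \<ominus> a \<in> Units R"
    and xy: "x \<in> carrier R" "y \<in> carrier R" "x \<oplus> y \<in> Units R"
  shows "x \<in> Units R \<or> y \<in> Units R"
proof -
  define u where "u = inv (x \<oplus> y)"
  have u: "u \<in> Units R" "u \<in> carrier R" "x \<oplus> y \<in> carrier R"
    using xy by (auto simp: u_def)
  have eq: "\<one> \<ominus> u \<otimes> x = u \<otimes> y"
  proof -
    have "u \<otimes> x \<oplus> u \<otimes> y = \<one>"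
      using xy u by (simp add: r_distr[symmetric] u_def)
    then show ?thesis
      using xy u(2) by (metis a_minus_def add.inv_solve_right add.m_comm m_closed one_closed)
  qed
  have U: "z \<in> Units R" if "z \<in> carrier R" "u \<otimes> z \<in> Units R" for z
  proof -
    have "(x \<oplus> y) \<otimes> (u \<otimes> z) = z"
      using that u xy by (simp add: m_assoc[symmetric] u_def)
    then show ?thesis
      using that(2) xy(3) by (metis Units_m_closed)
  qed
  have "u \<otimes> x \<in> Units R \<or> u \<otimes> y \<in> Units R"
    using loc[of "u \<otimes> x"] eq xy u(2) by simp
  then show ?thesis
    using U[OF xy(1)] U[OF xy(2)] by blast
qed

lemma Units_right_factor:
  assumes "finite (carrier R)" "x \<in> carrier R" "y \<in> carrier R" "x \<otimes> y \<in> Units R"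
  shows "y \<in> Units R"
proof (rule Units_if_no_right_annihilator)
  fix z assume z: "z \<in> carrier R" "y \<otimes> z = \<zero>"
  then have "(x \<otimes> y) \<otimes> z = \<zero>"
    using assms by (simp add: m_assoc)
  then have "inv (x \<otimes> y) \<otimes> (x \<otimes> y) \<otimes> z = \<zero>"
    using assms(4) z(1) by (simp add: m_assoc Units_closed del: Units_l_inv)
  then show "z = \<zero>"
    using assms(4) z(1) by simp
qed (use assms in auto)

text \<open>Take a nonzero idempotent \<open>e\<close> below \<open>f\<close> whose corner is
  smallest. A nonzero idempotent \<open>x\<close> of eRe has xRx inside eRe, so the two agree by
  minimality; then \<open>e\<close> lies in xRx and \<open>x = x e = e\<close>. Thus eRe has no
  idempotents but 0 and \<open>e\<close>, and is local.\<close>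

lemma local_idempotent_exists:
  assumes "finite (carrier R)" "f \<in> carrier R" "f \<otimes> f = f" "f \<noteq> \<zero>"
  shows "\<exists>e. local_idempotent R e \<and> f \<otimes> e = e \<and> e \<otimes> f = e"
proof -
  define S where "S = {e \<in> carrier R. e \<otimes> e = e \<and> e \<noteq> \<zero> \<and> f \<otimes> e = e \<and> e \<otimes> f = e}"
  have "f \<in> S" using assms by (simp add: S_def)
  then obtain e where e: "e \<in> S"
    and min: "\<And>x. x \<in> S \<Longrightarrow> card (carrier (corner R e)) \<le> card (carrier (corner R x))"
    using ex_has_least_nat[of "\<lambda>x. x \<in> S" f "\<lambda>x. card (carrier (corner R x))"] by blast
  have ee: "e \<in> carrier R" "e \<otimes> e = e" "e \<noteq> \<zero>" "f \<otimes> e = e" "e \<otimes> f = e"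
    using e by (auto simp: S_def)
  interpret C: ring "corner R e" using ring_corner ee by blast
  have fin: "finite (carrier (corner R e))" using assms(1) by simp
  have idem: "x = \<zero>\<^bsub>corner R e\<^esub> \<or> x = \<one>\<^bsub>corner R e\<^esub>"
    if x: "x \<in> carrier (corner R e)" "x \<otimes>\<^bsub>corner R e\<^esub> x = x" for x
  proof (cases "x = \<zero>")
    case False
    have x': "x \<in> carrier R" "e \<otimes> x = x" "x \<otimes> e = x" "x \<otimes> x = x"
      using x by auto
    have "f \<otimes> x = x" "x \<otimes> f = x"
      using x' ee assms(2) by (metis m_assoc)+
    then have "x \<in> S"
      using x' False by (simp add: S_def)
    moreover have "carrier (corner R x) \<subseteq> carrier (corner R e)"
    proof
      fix y assume y: "y \<in> carrier (corner R x)"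
      then have "y \<in> carrier R" "x \<otimes> y = y" "y \<otimes> x = y" by auto
      then have "e \<otimes> y = y" "y \<otimes> e = y"
        using x' ee(1) by (metis m_assoc)+
      then show "y \<in> carrier (corner R e)" using y by simp
    qed
    ultimately have "carrier (corner R x) = carrier (corner R e)"
      using min card_seteq[OF fin] by blast
    moreover have "e \<in> carrier (corner R e)" using ee by simp
    ultimately have "e \<in> carrier (corner R x)" by simp
    then show ?thesis using x' by simp
  qed simp
  have "a \<in> Units (corner R e) \<or> e \<ominus> a \<in> Units (corner R e)"
    if "a \<in> carrier (corner R e)" for a
    using C.local_if_trivial_idempotents[OF fin that idem] a_minus_corner[OF ee(1,2) that]
    by (simp del: corner_simps(1))
  then show ?thesis
    using ee unfolding local_idempotent_def by blast
qed

lemma local_idempotent_add_Units: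
  assumes "local_idempotent R e" "x \<in> carrier (corner R e)" "y \<in> carrier (corner R e)"
    "x \<oplus> y \<in> Units (corner R e)"
  shows "x \<in> Units (corner R e) \<or> y \<in> Units (corner R e)"
proof -
  have e: "e \<in> carrier R" "e \<otimes> e = e"
    using assms(1) by (auto simp: local_idempotent_def)
  interpret C: ring "corner R e" using ring_corner e by blast
  show ?thesis
  proof (rule C.local_add_Units)
    fix a assume a: "a \<in> carrier (corner R e)"
    then show "a \<in> Units (corner R e) \<or> \<one>\<^bsub>corner R e\<^esub> \<ominus>\<^bsub>corner R e\<^esub> a \<in> Units (corner R e)"
      using assms(1) a_minus_corner[OF e a] by (simp add: local_idempotent_def del: corner_simps(1))
  qed (use assms in simp_all)
qed

lemma corner_UnitsE:
  assumes "u \<in> Units (corner R e)"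
  obtains w where "w \<in> carrier R" "e \<otimes> w = w" "w \<otimes> e = w" "w \<otimes> u = e" "u \<otimes> w = e"
  using assms unfolding Units_def by auto

lemma corner_Units_minus:
  assumes "e \<in> carrier R" "e \<otimes> e = e" "u \<in> Units (corner R e)"
  shows "\<ominus> u \<in> Units (corner R e)"
proof -
  interpret C: ring "corner R e" using ring_corner assms by blast
  show ?thesis
    using C.Units_minus[OF assms(3)] a_inv_corner[OF assms(1,2) C.Units_closed[OF assms(3)]] by simp
qed

lemma zero_not_corner_Unit:
  assumes "e \<in> carrier R" "e \<noteq> \<zero>"
  shows "\<zero> \<notin> Units (corner R e)"
  using assms by (auto elim!: corner_UnitsE)

lemma sandwich_in_corner:
  assumes "e \<in> carrier R" "e \<otimes> e = e" "x \<in> carrier R"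
  shows "e \<otimes> x \<otimes> e \<in> carrier (corner R e)"
  using assms by (simp add: m_assoc) (simp add: m_assoc[symmetric])

section \<open>Peirce decomposition and completion of a column to a unit\<close>

lemma complement_idempotent:
  assumes "e \<in> carrier R" "e \<otimes> e = e"
  shows "\<one> \<ominus> e \<in> carrier R" "(\<one> \<ominus> e) \<otimes> (\<one> \<ominus> e) = \<one> \<ominus> e"
    "e \<otimes> (\<one> \<ominus> e) = \<zero>" "(\<one> \<ominus> e) \<otimes> e = \<zero>" "e \<oplus> (\<one> \<ominus> e) = \<one>"
proof -
  show 0: "\<one> \<ominus> e \<in> carrier R" using assms by simp
  show 1: "e \<otimes> (\<one> \<ominus> e) = \<zero>" "(\<one> \<ominus> e) \<otimes> e = \<zero>"
    using assms by (simp_all add: a_minus_def l_distr r_distr l_minus r_minus r_neg)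
  then show "(\<one> \<ominus> e) \<otimes> (\<one> \<ominus> e) = \<one> \<ominus> e"
    using assms 0 by (subst (1) a_minus_def) (simp add: l_distr l_minus)
  show "e \<oplus> (\<one> \<ominus> e) = \<one>"
    using assms by (simp add: a_minus_def a_lcomm[of e \<one>] r_neg)
qed

lemma peirce_split:
  assumes "e \<in> carrier R" "e \<otimes> e = e" "z \<in> carrier R"
  shows "z = e \<otimes> z \<oplus> (\<one> \<ominus> e) \<otimes> z" "z = z \<otimes> e \<oplus> z \<otimes> (\<one> \<ominus> e)"
  using complement_idempotent[OF assms(1,2)] assms
  by (simp_all add: l_distr[symmetric] r_distr[symmetric])

text \<open>In Peirce blocks for \<open>e\<close> and \<open>g = 1 - e\<close>, the first column of
  \<open>x\<close> is \<open>(a, c)\<close>. As in the proof that local rings have stable range 1,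
  locality yields \<open>b\<close> with \<open>a + b c\<close> a unit of eRe; the block matrix with
  rows \<open>(a, -b)\<close> and \<open>(c, g)\<close> is then invertible.\<close>

lemma Units_column_completion:
  assumes fin: "finite (carrier R)" and loc: "local_idempotent R e"
    and x: "x \<in> carrier R" and r: "r \<in> carrier R" "e \<otimes> r \<otimes> x \<otimes> e \<in> Units (corner R e)"
  shows "\<exists>y\<in>Units R. y \<otimes> e = x \<otimes> e"
proof -
  have e: "e \<in> carrier R" "e \<otimes> e = e"
    using loc by (auto simp: local_idempotent_def)
  define g where "g = \<one> \<ominus> e"
  note ge = complement_idempotent[OF e, folded g_def]
  interpret C: ring "corner R e" using ring_corner e by blast
  define a c where "a = e \<otimes> x \<otimes> e" and "c = g \<otimes> x \<otimes> e"
  have ac: "a \<in> carrier R" "c \<in> carrier R" "c \<otimes> e = c" "g \<otimes> c = c"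
    using e ge x by (simp_all add: a_def c_def m_assoc) (simp add: m_assoc[symmetric])
  have aC: "a \<in> carrier (corner R e)"
    unfolding a_def by (rule sandwich_in_corner) (use e x in auto)
  have xe: "x \<otimes> e = a \<oplus> c"
    using peirce_split(1)[OF e, of "x \<otimes> e"] e x ge(1) by (simp add: a_def c_def g_def m_assoc)
  obtain b where b: "b \<in> carrier R" "e \<otimes> b = b" "b \<otimes> g = b" "a \<oplus> b \<otimes> c \<in> Units (corner R e)"
  proof (cases "a \<in> Units (corner R e)")
    case True
    then show ?thesis
      using that[of \<zero>] e ge ac by simp
  next
    case False
    \<comment> \<open>Splitting \<open>r\<close> along \<open>e\<close> and \<open>g\<close> writes
      the given unit as \<open>(e r e) a + b c\<close>. The first summand is a non-unit because its
      right factor \<open>a\<close> is one, so locality makes \<open>b c\<close> a unit.\<close>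
    define b where "b = e \<otimes> r \<otimes> g"
    have b: "b \<in> carrier R" "e \<otimes> b = b" "b \<otimes> g = b"
      using e r ge by (simp_all add: b_def m_assoc) (simp add: m_assoc[symmetric])
    have "b \<otimes> c = e \<otimes> (r \<otimes> c) \<otimes> e"
      using e r(1) ge ac by (simp add: b_def m_assoc)
    then have bcC: "b \<otimes> c \<in> carrier (corner R e)"
      using sandwich_in_corner[OF e, of "r \<otimes> c"] r(1) ac by simp
    have erC: "e \<otimes> r \<otimes> e \<in> carrier (corner R e)"
      by (rule sandwich_in_corner) (use e r in auto)
    have "e \<otimes> r \<otimes> x \<otimes> e = e \<otimes> r \<otimes> a \<oplus> e \<otimes> r \<otimes> c"
      using e r(1) x xe ac by (simp add: m_assoc r_distr)
    also have "e \<otimes> r \<otimes> a = (e \<otimes> r \<otimes> e) \<otimes> a"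
      using e r(1) aC by (simp add: m_assoc)
    also have "e \<otimes> r \<otimes> c = b \<otimes> c"
      using e r(1) ac ge(1) by (simp add: b_def m_assoc)
    finally have "(e \<otimes> r \<otimes> e) \<otimes> a \<oplus> b \<otimes> c \<in> Units (corner R e)"
      using r(2) by simp
    moreover have "(e \<otimes> r \<otimes> e) \<otimes> a \<in> carrier (corner R e)"
      using C.m_closed[OF erC aC] by (simp del: corner_simps(1))
    moreover have "(e \<otimes> r \<otimes> e) \<otimes> a \<notin> Units (corner R e)"
      using C.Units_right_factor[OF _ erC aC] False fin by auto
    ultimately have bcU: "b \<otimes> c \<in> Units (corner R e)"
      using local_idempotent_add_Units[OF loc _ bcC] by blast
    have sC: "a \<oplus> b \<otimes> c \<in> carrier (corner R e)"
      using C.a_closed[OF aC bcC] by (simp del: corner_simps(1))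
    have mC: "\<ominus> a \<in> carrier (corner R e)"
      using C.a_inv_closed[OF aC] a_inv_corner[OF e aC] by (simp del: corner_simps(1))
    \<comment> \<open>If \<open>a + b c\<close> were a non-unit, the unit \<open>b c\<close> would
      be a sum of two non-units.\<close>
    have "(a \<oplus> b \<otimes> c) \<oplus> \<ominus> a = b \<otimes> c"
      using ac b(1) by (simp add: a_ac r_neg1 r_neg2)
    then have "a \<oplus> b \<otimes> c \<in> Units (corner R e) \<or> \<ominus> a \<in> Units (corner R e)"
      using local_idempotent_add_Units[OF loc sC mC] bcU by simp
    moreover have "\<ominus> a \<notin> Units (corner R e)"
      using corner_Units_minus[OF e, of "\<ominus> a"] False ac by auto
    ultimately show ?thesis
      using that b by blast
  qed
  obtain w where w: "w \<in> carrier R" "w \<otimes> (a \<oplus> b \<otimes> c) = e"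
    using corner_UnitsE[OF b(4)] by metis
  \<comment> \<open>The Schur complement of the block \<open>g\<close> in \<open>y\<close> is
    \<open>a + b c\<close>.\<close>
  define y where "y = (a \<oplus> c) \<oplus> (g \<oplus> \<ominus> b)"
  have y: "y \<in> carrier R" using ac ge b by (simp add: y_def)
  have ea: "e \<otimes> a = a" "a \<otimes> e = a" using aC by auto
  have ec: "e \<otimes> c = \<zero>"
    using ac e ge by (metis l_null m_assoc)
  have ga: "g \<otimes> a = \<zero>"
    using ea ac e ge by (metis l_null m_assoc)
  have gb: "g \<otimes> b = \<zero>"
    using b e ge by (metis l_null m_assoc)
  have be: "b \<otimes> e = \<zero>"
    using b e ge by (metis r_null m_assoc)
  have ey: "e \<otimes> y = a \<oplus> \<ominus> b" and gy: "g \<otimes> y = c \<oplus> g" and ye: "y \<otimes> e = x \<otimes> e"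
    using ac e ge b(1,2,3) ea ec ga gb be xe by (simp_all add: y_def l_distr r_distr r_minus l_minus)
  have "y \<in> Units R"
  proof (rule Units_if_no_right_annihilator[OF fin y])
    fix z assume z: "z \<in> carrier R" "y \<otimes> z = \<zero>"
    have "(a \<oplus> \<ominus> b) \<otimes> z = \<zero>" "(c \<oplus> g) \<otimes> z = \<zero>"
      using z y e(1) ge(1) by (simp_all add: ey[symmetric] gy[symmetric] m_assoc)
    then have 1: "a \<otimes> z \<oplus> \<ominus> (b \<otimes> z) = \<zero>" and 2: "c \<otimes> z \<oplus> g \<otimes> z = \<zero>"
      using z(1) ac b(1) ge(1) by (simp_all add: l_distr l_minus)
    \<comment> \<open>Adding \<open>b\<close> times the second row to the first one eliminates the
      term \<open>b z\<close> and leaves \<open>(a + b c) z = 0\<close>.\<close>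
    have "b \<otimes> (c \<otimes> z \<oplus> g \<otimes> z) = b \<otimes> c \<otimes> z \<oplus> b \<otimes> z"
      using z(1) ac b(1,3) ge(1) by (simp add: r_distr m_assoc[symmetric])
    then have 3: "b \<otimes> c \<otimes> z \<oplus> b \<otimes> z = \<zero>"
      using 2 b(1) by simp
    have "(a \<oplus> b \<otimes> c) \<otimes> z = (a \<otimes> z \<oplus> \<ominus> (b \<otimes> z)) \<oplus> (b \<otimes> c \<otimes> z \<oplus> b \<otimes> z)"
      using z(1) ac b(1) by (simp add: l_distr a_ac r_neg1 r_neg2 r_neg l_neg)
    then have "(a \<oplus> b \<otimes> c) \<otimes> z = \<zero>"
      using 1 3 by simp
    then have "w \<otimes> (a \<oplus> b \<otimes> c) \<otimes> z = \<zero>"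
      using w(1) ac b(1) z(1) by (simp add: m_assoc)
    then have ez: "e \<otimes> z = \<zero>"
      using w by simp
    then have "c \<otimes> z = \<zero>"
      using ac(2,3) e z(1) by (metis m_assoc r_null)
    then have "g \<otimes> z = \<zero>"
      using 2 z(1) ge(1) by simp
    then show "z = \<zero>"
      using peirce_split(1)[OF e z(1)] ez by (simp add: g_def)
  qed
  then show ?thesis using ye by blast
qed

section \<open>The left ideal of a local idempotent as a maximal independent set\<close>

lemma local_left_ideal_annihilated:
  assumes "local_idempotent R e" "x \<in> carrier R" "x \<otimes> e = \<zero>"
  shows "x \<in> local_left_ideal R e"
  using assms zero_not_corner_Unit[of e]
  by (auto simp: local_left_ideal_def local_idempotent_def m_assoc)

lemma Units_notin_local_left_ideal:
  assumes "local_idempotent R e" "u \<in> Units R"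
  shows "u \<notin> local_left_ideal R e"
proof
  assume "u \<in> local_left_ideal R e"
  then have "e \<otimes> inv u \<otimes> u \<otimes> e \<notin> Units (corner R e)"
    using assms(2) by (simp add: local_left_ideal_def)
  moreover have e: "e \<in> carrier R" "e \<otimes> e = e"
    using assms by (auto simp: local_idempotent_def)
  then have "e \<otimes> inv u \<otimes> u \<otimes> e = e"
    using assms(2) by (simp add: m_assoc Units_closed)
  moreover have "e \<in> Units (corner R e)"
    using e by (auto simp: Units_def)
  ultimately show False by simp
qed

text \<open>Closure under sums is where locality enters: \<open>e r (x + y) e\<close> splits into
  two non-units of eRe, which cannot add up to a unit. A sign is absorbed into
  \<open>r\<close>.\<close>

lemma additive_subgroup_local_left_ideal:
  assumes loc: "local_idempotent R e"
  shows "additive_subgroup (local_left_ideal R e) R"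
proof -
  have e: "e \<in> carrier R" "e \<otimes> e = e"
    using loc by (auto simp: local_idempotent_def)
  have "subgroup (local_left_ideal R e) (add_monoid R)"
  proof (rule group.subgroupI[OF a_group])
    show "local_left_ideal R e \<subseteq> carrier (add_monoid R)"
      by (auto simp: local_left_ideal_def)
    show "local_left_ideal R e \<noteq> {}"
      using local_left_ideal_annihilated[OF loc, of \<zero>] e by auto
    fix x assume x: "x \<in> local_left_ideal R e"
    then have xR: "x \<in> carrier R" by (simp add: local_left_ideal_def)
    have "e \<otimes> r \<otimes> (\<ominus> x) \<otimes> e \<notin> Units (corner R e)" if "r \<in> carrier R" for r
    proof -
      have "e \<otimes> r \<otimes> (\<ominus> x) \<otimes> e = e \<otimes> (\<ominus> r) \<otimes> x \<otimes> e"
        using that xR e by (simp add: l_minus r_minus)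
      then show ?thesis using x that by (simp add: local_left_ideal_def)
    qed
    then show "inv\<^bsub>add_monoid R\<^esub> x \<in> local_left_ideal R e"
      using xR by (simp add: local_left_ideal_def a_inv_def[symmetric])
    fix y assume y: "y \<in> local_left_ideal R e"
    then have yR: "y \<in> carrier R" by (simp add: local_left_ideal_def)
    have "e \<otimes> r \<otimes> (x \<oplus> y) \<otimes> e \<notin> Units (corner R e)" if r: "r \<in> carrier R" for r
    proof
      assume "e \<otimes> r \<otimes> (x \<oplus> y) \<otimes> e \<in> Units (corner R e)"
      then have "e \<otimes> r \<otimes> x \<otimes> e \<oplus> e \<otimes> r \<otimes> y \<otimes> e \<in> Units (corner R e)"
        using r xR yR e by (simp add: l_distr r_distr)
      moreover have "e \<otimes> r \<otimes> x \<otimes> e \<in> carrier (corner R e)" "e \<otimes> r \<otimes> y \<otimes> e \<in> carrier (corner R e)"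
        using sandwich_in_corner[OF e, of "r \<otimes> x"] sandwich_in_corner[OF e, of "r \<otimes> y"] r xR yR e
        by (simp_all add: m_assoc)
      ultimately show False
        using local_idempotent_add_Units[OF loc] x y r by (auto simp: local_left_ideal_def)
    qed
    then show "x \<otimes>\<^bsub>add_monoid R\<^esub> y \<in> local_left_ideal R e"
      using xR yR by (simp add: local_left_ideal_def)
  qed
  then show ?thesis by (simp add: additive_subgroup_def)
qed

text \<open>Sums stay in the ideal, which contains no units. For \<open>x\<close> outside it, column
  completion gives a unit \<open>y\<close> with \<open>y e = x e\<close>; then \<open>y - x\<close>
  is killed by \<open>e\<close>, hence lies in the ideal, and it is a neighbour of
  \<open>x\<close>.\<close>

lemma maximal_independent_local_left_ideal:
  assumes "finite (carrier R)" and loc: "local_idempotent R e"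
  shows "maximal_independent_set (unit_graph R) (local_left_ideal R e)"
proof -
  let ?M = "local_left_ideal R e"
  interpret M: additive_subgroup ?M R using additive_subgroup_local_left_ideal[OF loc] .
  have e: "e \<in> carrier R" using loc by (simp add: local_idempotent_def)
  have "independent_set (unit_graph R) ?M"
    using Units_notin_local_left_ideal[OF loc] M.a_closed M.a_Hcarr
    by (auto simp: independent_set_def unit_graph_def)
  moreover have "T \<subseteq> ?M" if T: "independent_set (unit_graph R) T" "?M \<subseteq> T" for T
  proof
    fix x assume xT: "x \<in> T"
    then have x: "x \<in> carrier R" using T by (auto simp: independent_set_def unit_graph_def)
    show "x \<in> ?M"
    proof (rule ccontr)
      assume xM: "x \<notin> ?M"
      then obtain r where "r \<in> carrier R" "e \<otimes> r \<otimes> x \<otimes> e \<in> Units (corner R e)"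
        using x unfolding local_left_ideal_def by blast
      then obtain y where y: "y \<in> Units R" "y \<otimes> e = x \<otimes> e"
        using Units_column_completion[OF assms(1) loc x] by blast
      have yR: "y \<in> carrier R" using y(1) by (rule Units_closed)
      have m: "y \<ominus> x \<in> ?M"
        by (rule local_left_ideal_annihilated[OF loc])
          (use e x y yR in \<open>simp_all add: a_minus_def l_distr l_minus r_neg\<close>)
      have "x \<oplus> (y \<ominus> x) = y"
        using x yR by (simp add: a_minus_def a_lcomm[of x y] r_neg)
      moreover have "x \<noteq> y \<ominus> x" using m xM by auto
      ultimately have "(x, y \<ominus> x) \<in> parcs (unit_graph R)"
        using x yR y(1) by (simp add: unit_graph_def)
      then show False
        using T xT m by (auto simp: independent_set_def)
    qed
  qed
  ultimately show ?thesis
    unfolding maximal_independent_set_def by blast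
qed

end

section \<open>A maximal independent set of even size\<close>

text \<open>Domination is asked of every \<open>x\<close>, also of members of \<open>D\<close>,
  where it forces \<open>x + x\<close> to be a unit. This surplus over maximal independence carries
  the induction, since a Schur complement in the corner may itself lie in \<open>D\<close>.\<close>

definition unit_dominating :: "('a, 'm) ring_scheme \<Rightarrow> 'a set \<Rightarrow> bool" where
  "unit_dominating R D \<longleftrightarrow> D \<subseteq> carrier R \<and>
     (\<forall>d\<in>D. \<forall>d'\<in>D. d \<noteq> d' \<longrightarrow> d \<oplus>\<^bsub>R\<^esub> d' \<notin> Units R) \<and>
     (\<forall>x\<in>carrier R. \<exists>d\<in>D. x \<oplus>\<^bsub>R\<^esub> d \<in> Units R)"

context ring
begin

lemma two_Unit_corner:
  assumes "f \<in> carrier R" "f \<otimes> f = f" "\<one> \<oplus> \<one> \<in> Units R"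
  shows "f \<oplus> f \<in> Units (corner R f)"
proof -
  obtain t where t: "t \<in> carrier R" "(\<one> \<oplus> \<one>) \<otimes> t = \<one>"
    using assms(3) unfolding Units_def by blast
  then have tt: "t \<oplus> t = \<one>" by (simp add: l_distr)
  have "(f \<oplus> f) \<otimes> (f \<otimes> t \<otimes> f) = f \<otimes> (t \<oplus> t) \<otimes> f"
    using assms(1,2) t(1) by (simp add: l_distr r_distr m_assoc[symmetric])
  moreover have "(f \<otimes> t \<otimes> f) \<otimes> (f \<oplus> f) = f \<otimes> (t \<oplus> t) \<otimes> f"
    using assms(1,2) t(1) by (simp add: l_distr r_distr m_assoc)
  moreover have "f \<otimes> t \<otimes> f \<in> carrier (corner R f)"
    using sandwich_in_corner assms(1,2) t(1) by blast
  moreover have "f \<oplus> f \<in> carrier (corner R f)"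
    using assms(1,2) by (simp add: l_distr r_distr)
  ultimately show ?thesis
    using tt assms(1,2) unfolding Units_def by auto
qed

text \<open>The last two hypotheses make \<open>u\<close> block diagonal with block \<open>v\<close>
  at \<open>f\<close>, so the corresponding block of \<open>inv u\<close> inverts
  \<open>v\<close>.\<close>

lemma Unit_corner_of_Unit:
  assumes f: "f \<in> carrier R" "f \<otimes> f = f" and u: "u \<in> Units R" and v: "v \<in> carrier (corner R f)"
    and "f \<otimes> u = v" "u \<otimes> f = v"
  shows "v \<in> Units (corner R f)"
proof -
  have R: "u \<in> carrier R" "inv u \<in> carrier R" "v \<in> carrier R" "f \<otimes> v = v" "v \<otimes> f = v"
    using u v by auto
  have "v \<otimes> (f \<otimes> inv u \<otimes> f) = v \<otimes> inv u \<otimes> f"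
    using R f by (simp add: m_assoc[symmetric])
  also have "\<dots> = f \<otimes> (u \<otimes> inv u) \<otimes> f"
    using R f(1) assms(5) by (simp add: m_assoc[symmetric] del: Units_r_inv)
  also have "\<dots> = f" using u f by simp
  finally have 1: "v \<otimes> (f \<otimes> inv u \<otimes> f) = f" .
  have "(f \<otimes> inv u \<otimes> f) \<otimes> v = f \<otimes> inv u \<otimes> v"
    using R f by (simp add: m_assoc)
  also have "\<dots> = f \<otimes> (inv u \<otimes> u) \<otimes> f"
    using R f(1) assms(6) by (simp add: m_assoc del: Units_l_inv)
  also have "\<dots> = f" using u f by simp
  finally have 2: "(f \<otimes> inv u \<otimes> f) \<otimes> v = f" .
  have "f \<otimes> inv u \<otimes> f \<in> carrier (corner R f)"
    using sandwich_in_corner f R by blast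
  then show ?thesis
    using 1 2 v unfolding Units_def by auto
qed

text \<open>Starting from the zero ring, this step produces the signed sums of a complete orthogonal family
  of local idempotents; in a product of matrix rings over fields of odd characteristic these are the
  diagonal matrices with entries 1 and -1. The Schur complement reduces the invertibility of
  \<open>x \<oplus> d\<close> to the corner of the complementary idempotent.\<close>

lemma unit_dominating_extend:
  assumes fin: "finite (carrier R)" and two: "\<one> \<oplus> \<one> \<in> Units R" and loc: "local_idempotent R e"
    and dom: "unit_dominating (corner R (\<one> \<ominus> e)) D"
  shows "\<exists>D'. unit_dominating R D' \<and> even (card D')"
proof -
  have e: "e \<in> carrier R" "e \<otimes> e = e" "e \<noteq> \<zero>"
    using loc by (auto simp: local_idempotent_def)
  define g where "g = \<one> \<ominus> e"
  note ge = complement_idempotent[OF e(1,2), folded g_def]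
  have eU: "e \<oplus> e \<in> Units (corner R e)"
    using two_Unit_corner[OF e(1,2) two] .
  have D: "D \<subseteq> carrier (corner R g)"
    and Dind: "\<And>d d'. d \<in> D \<Longrightarrow> d' \<in> D \<Longrightarrow> d \<noteq> d' \<Longrightarrow> d \<oplus> d' \<notin> Units (corner R g)"
    and Ddom: "\<And>x. x \<in> carrier (corner R g) \<Longrightarrow> \<exists>d\<in>D. x \<oplus> d \<in> Units (corner R g)"
    using dom[folded g_def] unfolding unit_dominating_def by (simp_all del: corner_simps(1))
  have dR: "d \<in> carrier R" "g \<otimes> d = d" "d \<otimes> g = d" "e \<otimes> d = \<zero>" "d \<otimes> e = \<zero>" if "d \<in> D" for d
  proof -
    show d: "d \<in> carrier R" "g \<otimes> d = d" "d \<otimes> g = d" using D that by auto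
    show "e \<otimes> d = \<zero>" using d(1,2) e(1) ge by (metis m_assoc l_null)
    show "d \<otimes> e = \<zero>" using d(1,3) e(1) ge by (metis m_assoc r_null)
  qed
  \<comment> \<open>The new set consists of two copies of \<open>D\<close>, shifted by
    \<open>e\<close> and by \<open>-e\<close>; their disjointness makes its size twice that of
    \<open>D\<close>.\<close>
  let ?P = "(\<lambda>d. e \<oplus> d) ` D" and ?N = "(\<lambda>d. \<ominus> e \<oplus> d) ` D"
  have finD: "finite D" using D fin by (auto intro: finite_subset)
  have "card ?P = card D" "card ?N = card D"
    using e(1) dR(1) by (auto intro!: card_image inj_onI)
  moreover have "?P \<inter> ?N = {}"
  proof (rule ccontr)
    assume "?P \<inter> ?N \<noteq> {}"
    then obtain d d' where d: "d \<in> D" "d' \<in> D" "e \<oplus> d = \<ominus> e \<oplus> d'" by auto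
    then have "(e \<oplus> d) \<otimes> e = (\<ominus> e \<oplus> d') \<otimes> e" by simp
    then have "e = \<ominus> e"
      using d(1,2) dR e by (simp add: l_distr l_minus)
    then have "e \<oplus> e = \<zero>" using e(1) by (metis r_neg)
    then show False
      using eU zero_not_corner_Unit[OF e(1,3)] by simp
  qed
  ultimately have even: "even (card (?P \<union> ?N))"
    using finD by (simp add: card_Un_disjoint)
  have sub: "?P \<union> ?N \<subseteq> carrier R" using e(1) dR(1) by auto
  have ind: "x \<oplus> y \<notin> Units R" if xy: "x \<in> ?P \<union> ?N" "y \<in> ?P \<union> ?N" "x \<noteq> y" for x y
  proof
    assume U: "x \<oplus> y \<in> Units R"
    obtain s d where s: "s \<in> {e, \<ominus> e}" "d \<in> D" "x = s \<oplus> d" using xy(1) by auto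
    obtain s' d' where s': "s' \<in> {e, \<ominus> e}" "d' \<in> D" "y = s' \<oplus> d'" using xy(2) by auto
    have sR: "s \<in> carrier R" "s' \<in> carrier R" "g \<otimes> s = \<zero>" "s \<otimes> g = \<zero>" "g \<otimes> s' = \<zero>" "s' \<otimes> g = \<zero>"
      using s(1) s'(1) e ge by (auto simp: l_minus r_minus)
    note d = dR[OF s(2)] dR[OF s'(2)]
    show False
    \<comment> \<open>With equal signs, a unit \<open>x + y\<close> would have the unit block
      \<open>d + d'\<close> in the corner of \<open>g\<close>, against independence of
      \<open>D\<close>. With opposite signs the \<open>e\<close> block cancels, so
      \<open>x + y\<close> annihilates \<open>e\<close>.\<close>
    proof (cases "s = s'")
      case True
      then have "d \<noteq> d'" using s(3) s'(3) xy(3) by auto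
      moreover have "d \<oplus> d' \<in> Units (corner R g)"
      proof (rule Unit_corner_of_Unit[OF ge(1,2) U])
        show "d \<oplus> d' \<in> carrier (corner R g)"
          using d ge(1) by (simp add: l_distr r_distr)
        show "g \<otimes> (x \<oplus> y) = d \<oplus> d'" "(x \<oplus> y) \<otimes> g = d \<oplus> d'"
          using d ge(1) sR s(3) s'(3) by (simp_all add: l_distr r_distr)
      qed
      ultimately show False using Dind s(2) s'(2) by blast
    next
      case False
      then have "s \<oplus> s' = \<zero>"
        using s(1) s'(1) e(1) by (auto simp: r_neg l_neg)
      moreover have "x \<oplus> y = (s \<oplus> s') \<oplus> (d \<oplus> d')"
        using s(3) s'(3) sR(1,2) d(1,6) by (simp add: a_ac)
      ultimately have "(x \<oplus> y) \<otimes> e = \<zero>"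
        using d e(1) by (simp add: l_distr)
      then have "inv (x \<oplus> y) \<otimes> (x \<oplus> y) \<otimes> e = \<zero>"
        using U e(1) by (simp add: m_assoc Units_closed del: Units_l_inv)
      then show False using U e by simp
    qed
  qed
  have ex: "\<exists>d\<in>?P \<union> ?N. x \<oplus> d \<in> Units R" if x: "x \<in> carrier R" for x
  proof -
    interpret C: ring "corner R e" using ring_corner e by blast
    define a where "a = e \<otimes> x \<otimes> e"
    have aR: "a \<in> carrier R" "e \<otimes> a = a" "a \<otimes> e = a" and aC: "a \<in> carrier (corner R e)"
      using sandwich_in_corner[OF e(1,2) x] by (auto simp: a_def)
    have aeC: "a \<oplus> e \<in> carrier (corner R e)" "e \<oplus> \<ominus> a \<in> carrier (corner R e)"
      using aR e by (simp_all add: l_distr r_distr l_minus r_minus)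
    \<comment> \<open>Choice of the sign: \<open>a + e\<close> and \<open>e - a\<close> add up to
      the unit \<open>e + e\<close> of eRe, so one of them is a unit by locality.\<close>
    have "(a \<oplus> e) \<oplus> (e \<oplus> \<ominus> a) = e \<oplus> e"
      using aR(1) e(1) by algebra
    then consider "a \<oplus> e \<in> Units (corner R e)" | "e \<oplus> \<ominus> a \<in> Units (corner R e)"
      using local_idempotent_add_Units[OF loc aeC] eU by auto
    then obtain s where s: "s \<in> {e, \<ominus> e}" "a \<oplus> s \<in> Units (corner R e)"
    proof cases
      case 2
      then have "\<ominus> (e \<oplus> \<ominus> a) \<in> Units (corner R e)"
        using corner_Units_minus[OF e(1,2)] by blast
      moreover have "\<ominus> (e \<oplus> \<ominus> a) = a \<oplus> \<ominus> e"
        using aR e by (simp add: minus_add a_comm)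
      ultimately show ?thesis using that[of "\<ominus> e"] by simp
    qed (use that[of e] in auto)
    have sR: "s \<in> carrier R" "e \<otimes> s = s" "s \<otimes> e = s" "g \<otimes> s = \<zero>"
      using s(1) e ge by (auto simp: l_minus r_minus)
    obtain w where w: "w \<in> carrier R" "e \<otimes> w = w" "w \<otimes> (a \<oplus> s) = e"
      using corner_UnitsE[OF s(2)] by metis
    define b where "b = e \<otimes> x \<otimes> g"
    define c where "c = g \<otimes> x \<otimes> e"
    define k where "k = g \<otimes> x \<otimes> g"
    have bR: "b \<in> carrier R" "c \<in> carrier R" "k \<in> carrier R" "b \<otimes> g = b" "g \<otimes> c = c" "c \<otimes> e = c"
      "g \<otimes> k = k" "k \<otimes> g = k"
      using sandwich_in_corner[OF ge(1,2) x] x e ge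
      by (auto simp: b_def c_def k_def m_assoc) (auto simp: m_assoc[symmetric])
    \<comment> \<open>This is the Schur complement of the block \<open>a + s\<close> in
      \<open>x + s\<close>; domination in the corner of \<open>g\<close> supplies a \<open>d\<close>
      that turns it into a unit.\<close>
    have "k \<oplus> \<ominus> (c \<otimes> w \<otimes> b) \<in> carrier (corner R g)"
      using bR w(1) ge(1) by (simp add: r_distr l_distr r_minus l_minus m_assoc)
        (simp add: m_assoc[symmetric])
    then obtain d where d: "d \<in> D" "(k \<oplus> \<ominus> (c \<otimes> w \<otimes> b)) \<oplus> d \<in> Units (corner R g)"
      using Ddom by blast
    obtain v where v: "v \<in> carrier R" "v \<otimes> ((k \<oplus> \<ominus> (c \<otimes> w \<otimes> b)) \<oplus> d) = g"
      using corner_UnitsE[OF d(2)] by metis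
    note dd = dR[OF d(1)]
    have "x \<oplus> (s \<oplus> d) \<in> Units R"
    proof (rule Units_if_no_right_annihilator[OF fin])
      show "x \<oplus> (s \<oplus> d) \<in> carrier R" using x sR dd by simp
      fix z assume z: "z \<in> carrier R" "(x \<oplus> (s \<oplus> d)) \<otimes> z = \<zero>"
      have "e \<otimes> x = a \<oplus> b" "g \<otimes> x = c \<oplus> k"
        using peirce_split(2)[OF e(1,2), of "e \<otimes> x"] peirce_split(2)[OF e(1,2), of "g \<otimes> x"] e(1) x ge(1)
        by (simp_all add: a_def b_def c_def k_def g_def)
      then have "e \<otimes> (x \<oplus> (s \<oplus> d)) = (a \<oplus> s) \<oplus> b" "g \<otimes> (x \<oplus> (s \<oplus> d)) = c \<oplus> (k \<oplus> d)"
        using e(1) ge(1) x sR dd aR bR by (simp_all add: r_distr a_ac)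
      then have "((a \<oplus> s) \<oplus> b) \<otimes> z = \<zero>" "(c \<oplus> (k \<oplus> d)) \<otimes> z = \<zero>"
        using z x sR(1) dd(1) e(1) ge(1) by (metis m_assoc r_null a_closed)+
      then have 1: "(a \<oplus> s) \<otimes> z \<oplus> b \<otimes> z = \<zero>" and 2: "c \<otimes> z \<oplus> (k \<oplus> d) \<otimes> z = \<zero>"
        using z(1) sR(1) dd(1) aR(1) bR(1-3) by (simp_all add: l_distr)
      have "w \<otimes> ((a \<oplus> s) \<otimes> z \<oplus> b \<otimes> z) = e \<otimes> z \<oplus> w \<otimes> b \<otimes> z"
        using w(1,3) z(1) sR(1) aR(1) bR(1) e(1) by (simp add: r_distr m_assoc[symmetric])
      then have 3: "e \<otimes> z \<oplus> w \<otimes> b \<otimes> z = \<zero>"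
        using 1 w(1) by simp
      have "c \<otimes> (e \<otimes> z \<oplus> w \<otimes> b \<otimes> z) = c \<otimes> z \<oplus> c \<otimes> w \<otimes> b \<otimes> z"
        using w(1) z(1) bR e(1) by (simp add: r_distr m_assoc[symmetric])
      then have 4: "c \<otimes> z \<oplus> c \<otimes> w \<otimes> b \<otimes> z = \<zero>"
        using 3 bR by simp
      \<comment> \<open>Subtracting \<open>c w\<close> times the first row from the second leaves
        the Schur complement plus \<open>d\<close> acting on \<open>z\<close>.\<close>
      have "((k \<oplus> \<ominus> (c \<otimes> w \<otimes> b)) \<oplus> d) \<otimes> z =
        (c \<otimes> z \<oplus> (k \<oplus> d) \<otimes> z) \<oplus> \<ominus> (c \<otimes> z \<oplus> c \<otimes> w \<otimes> b \<otimes> z)"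
        using z(1) bR(1-3) w(1) dd(1) by algebra
      then have "((k \<oplus> \<ominus> (c \<otimes> w \<otimes> b)) \<oplus> d) \<otimes> z = \<zero>"
        using 2 4 by simp
      then have "v \<otimes> ((k \<oplus> \<ominus> (c \<otimes> w \<otimes> b)) \<oplus> d) \<otimes> z = \<zero>"
        using v(1) z(1) bR w(1) dd(1) by (simp add: m_assoc)
      then have gz: "g \<otimes> z = \<zero>" using v by simp
      have "w \<otimes> b \<otimes> z = w \<otimes> b \<otimes> (g \<otimes> z)"
        using w(1) bR ge(1) z(1) by (simp add: m_assoc[symmetric]) (simp add: m_assoc)
      then have "e \<otimes> z = \<zero>"
        using 3 gz w(1) bR e(1) z(1) by simp
      then show "z = \<zero>"
        using peirce_split(1)[OF e(1,2) z(1)] gz by (simp add: g_def)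
    qed
    then show ?thesis using s(1) d(1) by auto
  qed
  have "unit_dominating R (?P \<union> ?N)"
    unfolding unit_dominating_def using sub ind ex by (intro conjI ballI impI) simp_all
  then show ?thesis using even by blast
qed

end

text \<open>Induction on the size of the ring: the corner of \<open>1 - e\<close> misses
  \<open>e\<close>, so it is smaller, and an extension step doubles the set. The parity claim is
  guarded because the induction starts at the zero ring, where 0 is a unit and the set is a
  singleton.\<close>

lemma even_unit_dominating_exists:
  fixes R :: "('a, 'm) ring_scheme"
  assumes "ring R" "finite (carrier R)" "\<one>\<^bsub>R\<^esub> \<oplus>\<^bsub>R\<^esub> \<one>\<^bsub>R\<^esub> \<in> Units R"
  shows "\<exists>D. unit_dominating R D \<and> (\<one>\<^bsub>R\<^esub> \<noteq> \<zero>\<^bsub>R\<^esub> \<longrightarrow> even (card D))"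
  using assms
proof (induction "card (carrier R)" arbitrary: R rule: less_induct)
  case (less R)
  interpret ring R by fact
  note fin = \<open>finite (carrier R)\<close>
  show ?case
  proof (cases "\<one>\<^bsub>R\<^esub> = \<zero>\<^bsub>R\<^esub>")
    case True
    then have "carrier R = {\<zero>\<^bsub>R\<^esub>}"
      by (simp add: carrier_one_zero)
    moreover have "\<zero>\<^bsub>R\<^esub> \<in> Units R"
      using True Units_one_closed by simp
    ultimately show ?thesis
      using True by (intro exI[of _ "{\<zero>\<^bsub>R\<^esub>}"]) (auto simp: unit_dominating_def)
  next
    case False
    then obtain e where loc: "local_idempotent R e"
      using local_idempotent_exists[OF fin, of "\<one>\<^bsub>R\<^esub>"] by auto
    then have e: "e \<in> carrier R" "e \<otimes>\<^bsub>R\<^esub> e = e" "e \<noteq> \<zero>\<^bsub>R\<^esub>"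
      by (auto simp: local_idempotent_def)
    let ?g = "\<one>\<^bsub>R\<^esub> \<ominus>\<^bsub>R\<^esub> e"
    note ge = complement_idempotent[OF e(1,2)]
    have "card (carrier (corner R ?g)) < card (carrier R)"
    proof (rule psubset_card_mono[OF fin])
      have "e \<notin> carrier (corner R ?g)" using ge e by simp
      then show "carrier (corner R ?g) \<subset> carrier R" using e by auto
    qed
    moreover have "ring (corner R ?g)" "finite (carrier (corner R ?g))"
      using ring_corner ge fin by auto
    moreover have "\<one>\<^bsub>corner R ?g\<^esub> \<oplus>\<^bsub>corner R ?g\<^esub> \<one>\<^bsub>corner R ?g\<^esub> \<in> Units (corner R ?g)"
      using two_Unit_corner[OF ge(1,2)] less.prems by simp
    ultimately obtain D where "unit_dominating (corner R ?g) D"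
      using less.hyps[of "corner R ?g"] by blast
    then show ?thesis
      using unit_dominating_extend[OF fin _ loc] less.prems by blast
  qed
qed

section \<open>Parity of indices and the Jacobson radical\<close>

text \<open>Sylow's theorem with exponent 1, rather than the full power of 2 in the order, yields a
  subgroup of order 2. Conversely, an involution has order 2, which divides the group order.\<close>

lemma (in group) even_order_iff_involution:
  assumes "finite (carrier G)"
  shows "even (order G) \<longleftrightarrow> (\<exists>x\<in>carrier G. x \<noteq> \<one> \<and> x \<otimes> x = \<one>)"
proof
  assume "even (order G)"
  then obtain m where "order G = 2 ^ 1 * m" by (auto elim: evenE)
  then obtain H where H: "subgroup H G" "card H = 2"
    using sylow_thm[of 2 G 1 m] assms is_group by auto
  then obtain a b where ab: "H = {a, b}" "a \<noteq> b" by (auto simp: card_2_iff)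
  have "\<one> = a \<or> \<one> = b" using subgroup.one_closed[OF H(1)] ab by simp
  then obtain x where x: "x \<in> H" "x \<noteq> \<one>" "H = {\<one>, x}"
    using that[of a] that[of b] ab by (auto simp: insert_commute)
  have "x \<in> carrier G" using x(1) H(1) subgroup.mem_carrier by metis
  moreover have "x \<otimes> x \<in> {\<one>, x}"
    using subgroup.m_closed[OF H(1) x(1) x(1)] x(3) by simp
  ultimately show "\<exists>x\<in>carrier G. x \<noteq> \<one> \<and> x \<otimes> x = \<one>"
    using x(2) by auto
next
  assume "\<exists>x\<in>carrier G. x \<noteq> \<one> \<and> x \<otimes> x = \<one>"
  then obtain x where x: "x \<in> carrier G" "x \<noteq> \<one>" "x \<otimes> x = \<one>" by blast
  then have "x [^] (2::nat) = \<one>" by (simp add: numeral_2_eq_2)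
  then have "ord x dvd 2" using pow_eq_id[OF x(1)] by simp
  moreover have "ord x \<noteq> 1" using ord_eq_1[OF x(1)] x(2) by simp
  ultimately have "ord x = 2"
    using two_is_prime_nat prime_nat_iff by blast
  then show "even (order G)" using ord_dvd_group_order[OF x(1)] by simp
qed

lemma unit_dominating_maximal_independent:
  assumes "unit_dominating R D"
  shows "maximal_independent_set (unit_graph R) D"
proof -
  have "T = D" if T: "independent_set (unit_graph R) T" "D \<subseteq> T" for T
  proof (rule ccontr)
    assume "T \<noteq> D"
    then obtain x where x: "x \<in> T" "x \<notin> D" using T by blast
    then have "x \<in> carrier R" using T by (auto simp: independent_set_def unit_graph_def)
    then obtain d where "d \<in> D" "x \<oplus>\<^bsub>R\<^esub> d \<in> Units R"
      using assms unfolding unit_dominating_def by blast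
    then show False
      using T x assms \<open>x \<in> carrier R\<close>
      by (auto simp: independent_set_def unit_graph_def unit_dominating_def)
  qed
  moreover have "independent_set (unit_graph R) D"
    using assms by (auto simp: independent_set_def unit_graph_def unit_dominating_def)
  ultimately show ?thesis
    unfolding maximal_independent_set_def by blast
qed

context ring
begin

text \<open>The index is the order of the additive quotient group, whose involutions are the cosets
  of elements \<open>x\<close> outside \<open>M\<close> with \<open>x + x\<close> in
  \<open>M\<close>.\<close>

lemma even_index_iff:
  assumes "finite (carrier R)" "additive_subgroup M R"
  shows "even (card (a_rcosets M)) \<longleftrightarrow> (\<exists>x\<in>carrier R. x \<notin> M \<and> x \<oplus> x \<in> M)"
proof -
  interpret M: abelian_subgroup M R
    using assms(2) abelian_group_axioms abelian_subgroupI3 by blast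
  interpret Q: group "R A_Mod M" by (rule M.a_factorgroup_is_group)
  have Q: "carrier (R A_Mod M) = a_rcosets M" "\<one>\<^bsub>R A_Mod M\<^esub> = M"
    "monoid.mult (R A_Mod M) = set_add R"
    by (auto simp: A_FactGroup_def FactGroup_def A_RCOSETS_def set_add_def)
  have Qc: "a_rcosets M = (\<lambda>x. M +> x) ` carrier R"
    by (auto simp: A_RCOSETS_def' a_r_coset_def)
  have coset_eq: "M +> x = M \<longleftrightarrow> x \<in> M" if "x \<in> carrier R" for x
    using that M.a_rcos_const M.a_rcos_self by auto
  have "finite (carrier (R A_Mod M))"
    using assms(1) Q Qc by simp
  then show ?thesis
    using Q.even_order_iff_involution Q Qc coset_eq M.a_rcos_sum
    by (simp add: order_def)
qed

section \<open>Powers of 2 and the index of the left ideal of a local idempotent\<close>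

lemma two_mult:
  assumes "x \<in> carrier R"
  shows "(\<one> \<oplus> \<one>) \<otimes> x = x \<oplus> x" "x \<otimes> (\<one> \<oplus> \<one>) = x \<oplus> x"
  using assms by (simp_all add: l_distr r_distr)

lemma two_pow_central:
  assumes "x \<in> carrier R"
  shows "(\<one> \<oplus> \<one>) [^] (n::nat) \<otimes> x = x \<otimes> (\<one> \<oplus> \<one>) [^] n"
proof (induction n)
  case (Suc n)
  let ?t = "\<one> \<oplus> \<one>"
  have "?t [^] Suc n \<otimes> x = ?t [^] n \<otimes> (?t \<otimes> x)"
    using assms by (simp add: m_assoc)
  also have "\<dots> = ?t [^] n \<otimes> x \<otimes> ?t"
    using assms two_mult[OF assms] by (simp add: m_assoc)
  also have "\<dots> = x \<otimes> ?t [^] Suc n"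
    using assms Suc by (simp add: m_assoc)
  finally show ?case .
qed (use assms in simp)

lemma local_left_ideal_mult:
  assumes "local_idempotent R e" "r \<in> carrier R" "x \<in> local_left_ideal R e"
  shows "r \<otimes> x \<in> local_left_ideal R e"
proof -
  have e: "e \<in> carrier R" and x: "x \<in> carrier R"
    using assms by (auto simp: local_idempotent_def local_left_ideal_def)
  have "e \<otimes> s \<otimes> (r \<otimes> x) \<otimes> e = e \<otimes> (s \<otimes> r) \<otimes> x \<otimes> e" if "s \<in> carrier R" for s
    using that e x assms(2) by (simp add: m_assoc)
  then show ?thesis
    using assms(2,3) x by (simp add: local_left_ideal_def)
qed

text \<open>Some power of 2 lies in the ideal while 1 does not. For the least exponent
  \<open>k\<close> of such a power, the power with exponent \<open>k - 1\<close> is an involution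
  modulo the ideal.\<close>

lemma even_index_local_left_ideal:
  assumes fin: "finite (carrier R)" and loc: "local_idempotent R e"
    and "(\<one> \<oplus> \<one>) [^] (n::nat) \<otimes> e = \<zero>"
  shows "even (card (a_rcosets (local_left_ideal R e)))"
proof -
  let ?M = "local_left_ideal R e" and ?t = "\<one> \<oplus> \<one>"
  have "?t [^] n \<in> ?M"
    using local_left_ideal_annihilated[OF loc] assms(3) by simp
  moreover define k where "k = (LEAST k. ?t [^] (k::nat) \<in> ?M)"
  ultimately have k: "?t [^] k \<in> ?M" "\<And>j. j < k \<Longrightarrow> ?t [^] j \<notin> ?M"
    by (auto intro: LeastI dest: not_less_Least)
  have "k \<noteq> 0"
    using k(1) Units_notin_local_left_ideal[OF loc, of \<one>] by (auto intro: gr0I)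
  then obtain j where j: "k = Suc j" using not0_implies_Suc by blast
  have "?t [^] j \<oplus> ?t [^] j \<in> ?M"
    using k(1) j two_mult(2)[of "?t [^] j"] by simp
  moreover have "?t [^] j \<in> carrier R" "?t [^] j \<notin> ?M" using k(2) j by simp_all
  ultimately show ?thesis
    using even_index_iff[OF fin additive_subgroup_local_left_ideal[OF loc]] by blast
qed

text \<open>Let \<open>h\<close> be the given power of 2. If \<open>2 x\<close> lies in the ideal,
  so does \<open>h x\<close>, since \<open>n > 0\<close>. The rest \<open>(1 - h) x\<close> lies
  there too: \<open>h\<close> is central and fixes \<open>e\<close>, so \<open>e\<close> annihilates
  it from the right. Hence \<open>x\<close> is in the ideal and the quotient has no
  involution.\<close>

lemma odd_index_local_left_ideal:
  assumes fin: "finite (carrier R)" and loc: "local_idempotent R e"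
    and n: "0 < n" "(\<one> \<oplus> \<one>) [^] (n::nat) \<otimes> e = e"
  shows "odd (card (a_rcosets (local_left_ideal R e)))"
proof -
  let ?M = "local_left_ideal R e" and ?t = "\<one> \<oplus> \<one>"
  interpret M: additive_subgroup ?M R using additive_subgroup_local_left_ideal[OF loc] .
  have e: "e \<in> carrier R" using loc by (simp add: local_idempotent_def)
  obtain k where k: "n = Suc k" using n(1) gr0_implies_Suc by blast
  have "x \<in> ?M" if x: "x \<in> carrier R" "x \<oplus> x \<in> ?M" for x
  proof -
    have "?t [^] n \<otimes> x = ?t [^] k \<otimes> (x \<oplus> x)"
      using x(1) k by (simp add: m_assoc two_mult(1))
    then have 1: "?t [^] n \<otimes> x \<in> ?M"
      using local_left_ideal_mult[OF loc _ x(2)] by simp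
    have "(\<one> \<ominus> ?t [^] n) \<otimes> x \<otimes> e = x \<otimes> e \<ominus> ?t [^] n \<otimes> x \<otimes> e"
      using x(1) e by (simp add: a_minus_def l_distr l_minus)
    also have "?t [^] n \<otimes> x \<otimes> e = x \<otimes> e"
      using x(1) e n(2) two_pow_central[OF x(1), of n] by (simp add: m_assoc)
    finally have "(\<one> \<ominus> ?t [^] n) \<otimes> x \<otimes> e = \<zero>"
      using x(1) e by simp
    then have 2: "(\<one> \<ominus> ?t [^] n) \<otimes> x \<in> ?M"
      using local_left_ideal_annihilated[OF loc] x(1) by simp
    have "x = ?t [^] n \<otimes> x \<oplus> (\<one> \<ominus> ?t [^] n) \<otimes> x"
      using x(1) nat_pow_closed[of ?t n] by algebra
    then show ?thesis using M.a_closed[OF 1 2] by simp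
  qed
  then show ?thesis
    using even_index_iff[OF fin additive_subgroup_local_left_ideal[OF loc]] by blast
qed

text \<open>Factor \<open>u + 2 y\<close> as \<open>u (1 - 2 s)\<close>. Since 2 is central and
  nilpotent, \<open>2 s\<close> is nilpotent, and \<open>z = 2 s z\<close> forces
  \<open>z = 0\<close>.\<close>

lemma Units_add_twice:
  assumes fin: "finite (carrier R)" and nil: "(\<one> \<oplus> \<one>) [^] (n::nat) = \<zero>"
    and u: "u \<in> Units R" and y: "y \<in> carrier R"
  shows "u \<oplus> (y \<oplus> y) \<in> Units R"
proof (rule Units_if_no_right_annihilator[OF fin])
  have uR: "u \<in> carrier R" "inv u \<in> carrier R" using u by auto
  show "u \<oplus> (y \<oplus> y) \<in> carrier R" using uR y by simp
  fix z assume z: "z \<in> carrier R" "(u \<oplus> (y \<oplus> y)) \<otimes> z = \<zero>"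
  define s where "s = \<ominus> (inv u \<otimes> y)"
  have s: "s \<in> carrier R" using uR y by (simp add: s_def)
  have "inv u \<otimes> ((u \<oplus> (y \<oplus> y)) \<otimes> z) = (inv u \<otimes> u) \<otimes> z \<oplus> (inv u \<otimes> y \<oplus> inv u \<otimes> y) \<otimes> z"
    using uR y z(1) by (simp add: r_distr l_distr m_assoc del: Units_l_inv)
  also have "\<dots> = z \<ominus> (s \<oplus> s) \<otimes> z"
    using u uR y z(1) by (simp add: s_def a_minus_def l_minus[symmetric] minus_add)
  finally have "z \<ominus> (s \<oplus> s) \<otimes> z = \<zero>" using z uR by simp
  then have "(s \<oplus> s) \<otimes> z = z" using z(1) s by simp
  moreover have "(s \<oplus> s) [^] n = \<zero>"
    using pow_mult_distrib[of "\<one> \<oplus> \<one>" s n] two_mult[OF s] nil s by simp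
  ultimately show "z = \<zero>"
    using zero_if_fixed_by_nilpotent[of "s \<oplus> s" z n] s z(1) by simp
qed

text \<open>The elements \<open>x + y\<close> and \<open>x - y\<close> differ by \<open>2 y\<close>,
  which does not affect being a unit.\<close>

lemma unit_graph_eq_unitary_cayley_graph:
  assumes "finite (carrier R)" "(\<one> \<oplus> \<one>) [^] (n::nat) = \<zero>"
  shows "unit_graph R = unitary_cayley_graph R"
proof -
  have "x \<oplus> y \<in> Units R \<longleftrightarrow> x \<ominus> y \<in> Units R" if xy: "x \<in> carrier R" "y \<in> carrier R" for x y
  proof
    have "(x \<oplus> y) \<oplus> (\<ominus> y \<oplus> \<ominus> y) = x \<ominus> y" "(x \<ominus> y) \<oplus> (y \<oplus> y) = x \<oplus> y"
      using xy by algebra+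
    note eq = this
    show "x \<ominus> y \<in> Units R" if "x \<oplus> y \<in> Units R"
      using Units_add_twice[OF assms that, of "\<ominus> y"] eq xy by simp
    show "x \<oplus> y \<in> Units R" if "x \<ominus> y \<in> Units R"
      using Units_add_twice[OF assms that, of y] eq xy by simp
  qed
  then show ?thesis
    unfolding unit_graph_def unitary_cayley_graph_def by auto
qed

section \<open>Left ideals, the Jacobson radical and the characteristic of the quotient\<close>

lemma left_ideal_additive_subgroup: "left_ideal I R \<Longrightarrow> additive_subgroup I R"
  by (simp add: left_ideal_def additive_subgroup_def)

lemma left_idealI:
  assumes "I \<subseteq> carrier R" "\<zero> \<in> I" "\<And>x y. x \<in> I \<Longrightarrow> y \<in> I \<Longrightarrow> x \<oplus> y \<in> I"
    and mult: "\<And>a x. a \<in> carrier R \<Longrightarrow> x \<in> I \<Longrightarrow> a \<otimes> x \<in> I"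
  shows "left_ideal I R"
proof -
  have "\<ominus> x \<in> I" if "x \<in> I" for x
    using mult[of "\<ominus> \<one>" x] that assms(1) by (auto simp: l_minus)
  then have "subgroup I (add_monoid R)"
    using assms by (intro group.subgroupI[OF a_group]) (auto simp: a_inv_def)
  then show ?thesis using mult by (simp add: left_ideal_def)
qed

lemma left_ideal_eq_carrier:
  assumes "left_ideal I R" "u \<in> I" "u \<in> Units R"
  shows "I = carrier R"
proof
  interpret I: additive_subgroup I R using left_ideal_additive_subgroup[OF assms(1)] .
  show "I \<subseteq> carrier R" by (rule I.a_subset)
  show "carrier R \<subseteq> I"
  proof
    fix x assume x: "x \<in> carrier R"
    then have "(x \<otimes> inv u) \<otimes> u \<in> I"
      using assms by (simp add: left_ideal_def)
    moreover have "(x \<otimes> inv u) \<otimes> u = x"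
      using x assms(3) by (simp add: m_assoc Units_closed)
    ultimately show "x \<in> I" by simp
  qed
qed

lemma maximal_left_ideal_exists:
  assumes fin: "finite (carrier R)" and L: "left_ideal L R" "L \<noteq> carrier R"
  shows "\<exists>I. maximal_left_ideal I R \<and> L \<subseteq> I"
proof -
  define S where "S = {I. left_ideal I R \<and> I \<noteq> carrier R \<and> L \<subseteq> I}"
  have "S \<subseteq> Pow (carrier R)"
    using left_ideal_additive_subgroup additive_subgroup.a_subset by (auto simp: S_def)
  then have "finite S" using fin finite_subset by blast
  moreover have "L \<in> S" using L by (simp add: S_def)
  ultimately obtain I where I: "I \<in> S" "\<forall>K\<in>S. I \<subseteq> K \<longrightarrow> I = K"
    using finite_has_maximal2[of S L] by metis
  have "K = I \<or> K = carrier R" if "left_ideal K R" "I \<subseteq> K" for K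
    using I that by (auto simp: S_def)
  then show ?thesis
    using I(1) by (intro exI[of _ I]) (simp add: S_def maximal_left_ideal_def)
qed

lemma left_ideal_jacobson_radical: "left_ideal (jacobson_radical R) R"
proof (rule left_idealI)
  have I: "additive_subgroup I R" "\<And>a x. a \<in> carrier R \<Longrightarrow> x \<in> I \<Longrightarrow> a \<otimes> x \<in> I"
    if "maximal_left_ideal I R" for I
    using that left_ideal_additive_subgroup by (auto simp: maximal_left_ideal_def left_ideal_def)
  show "jacobson_radical R \<subseteq> carrier R" "\<zero> \<in> jacobson_radical R"
    using additive_subgroup.zero_closed I(1) by (auto simp: jacobson_radical_def)
  show "x \<oplus> y \<in> jacobson_radical R" if "x \<in> jacobson_radical R" "y \<in> jacobson_radical R" for x y
    using that additive_subgroup.a_closed[OF I(1)] by (auto simp: jacobson_radical_def)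
  show "a \<otimes> x \<in> jacobson_radical R" if "a \<in> carrier R" "x \<in> jacobson_radical R" for a x
    using that I(2) by (auto simp: jacobson_radical_def)
qed

lemma one_notin_jacobson_radical:
  assumes "finite (carrier R)" "\<one> \<noteq> \<zero>"
  shows "\<one> \<notin> jacobson_radical R"
proof -
  have "left_ideal {\<zero>} R" by (rule left_idealI) auto
  moreover have "{\<zero>} \<noteq> carrier R" using assms(2) one_closed by blast
  ultimately obtain I where I: "maximal_left_ideal I R"
    using maximal_left_ideal_exists[OF assms(1)] by blast
  then have "\<one> \<notin> I"
    using left_ideal_eq_carrier[of I \<one>] by (auto simp: maximal_left_ideal_def)
  then show ?thesis using I by (auto simp: jacobson_radical_def)
qed

text \<open>For \<open>h\<close> nonzero, the left annihilator of \<open>h\<close> is proper and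
  contains \<open>1 - h\<close>. A maximal left ideal above it also contains \<open>h\<close>, hence
  1.\<close>

lemma idempotent_in_jacobson_radical:
  assumes fin: "finite (carrier R)" and h: "h \<in> jacobson_radical R" "h \<otimes> h = h"
  shows "h = \<zero>"
proof (rule ccontr)
  assume "h \<noteq> \<zero>"
  have hR: "h \<in> carrier R" using h(1) by (simp add: jacobson_radical_def)
  define L where "L = {x \<in> carrier R. x \<otimes> h = \<zero>}"
  have "left_ideal L R"
    by (rule left_idealI) (use hR in \<open>auto simp: L_def l_distr m_assoc\<close>)
  moreover have "\<one> \<notin> L" using hR \<open>h \<noteq> \<zero>\<close> by (simp add: L_def)
  then have "L \<noteq> carrier R" by blast
  ultimately obtain I where I: "maximal_left_ideal I R" "L \<subseteq> I"
    using maximal_left_ideal_exists[OF fin] by blast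
  interpret I: additive_subgroup I R
    using I(1) left_ideal_additive_subgroup by (simp add: maximal_left_ideal_def)
  have "h \<in> I" using h(1) I(1) by (auto simp: jacobson_radical_def)
  moreover have "\<one> \<ominus> h \<in> L"
    using complement_idempotent[OF hR h(2)] by (simp add: L_def)
  ultimately have "h \<oplus> (\<one> \<ominus> h) \<in> I" using I(2) by blast
  then have "\<one> \<in> I" using complement_idempotent(5)[OF hR h(2)] by simp
  then show False
    using I(1) left_ideal_eq_carrier[of I \<one>] by (auto simp: maximal_left_ideal_def)
qed

text \<open>If 2 is in the radical, so is its idempotent power, which must vanish. Conversely, if 2
  is nilpotent and lies outside a maximal left ideal \<open>I\<close>, then \<open>I + 2R\<close> is
  everything, and \<open>I\<close> contains some \<open>1 - 2 r\<close>, which is a unit.\<close>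

lemma two_in_jacobson_radical_iff:
  assumes fin: "finite (carrier R)"
    and n: "0 < n" "(\<one> \<oplus> \<one>) [^] (n::nat) \<otimes> (\<one> \<oplus> \<one>) [^] n = (\<one> \<oplus> \<one>) [^] n"
  shows "\<one> \<oplus> \<one> \<in> jacobson_radical R \<longleftrightarrow> (\<one> \<oplus> \<one>) [^] n = \<zero>"
proof
  assume J: "\<one> \<oplus> \<one> \<in> jacobson_radical R"
  obtain k where k: "n = Suc k" using n(1) gr0_implies_Suc by blast
  have "(\<one> \<oplus> \<one>) [^] n \<in> jacobson_radical R"
    using left_ideal_jacobson_radical J k by (simp add: left_ideal_def)
  then show "(\<one> \<oplus> \<one>) [^] n = \<zero>"
    using idempotent_in_jacobson_radical[OF fin _ n(2)] by blast
next
  assume nil: "(\<one> \<oplus> \<one>) [^] n = \<zero>"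
  have "\<one> \<oplus> \<one> \<in> I" if I: "maximal_left_ideal I R" for I
  proof (rule ccontr)
    assume t: "\<one> \<oplus> \<one> \<notin> I"
    have lI: "left_ideal I R" using I by (simp add: maximal_left_ideal_def)
    interpret I: additive_subgroup I R using lI by (rule left_ideal_additive_subgroup)
    \<comment> \<open>This is \<open>I + 2R\<close>, a left ideal because 2 is central.\<close>
    define K where "K = {i \<oplus> (r \<oplus> r) |i r. i \<in> I \<and> r \<in> carrier R}"
    have IK: "I \<subseteq> K"
    proof
      fix i assume "i \<in> I"
      then show "i \<in> K"
        using I.a_Hcarr unfolding K_def by (intro CollectI exI[of _ i] exI[of _ \<zero>]) simp
    qed
    have "left_ideal K R"
    proof (rule left_idealI)
      show "K \<subseteq> carrier R" using I.a_Hcarr by (auto simp: K_def)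
      show "\<zero> \<in> K" using IK I.zero_closed by blast
      fix x assume "x \<in> K"
      then obtain i r where x: "x = i \<oplus> (r \<oplus> r)" "i \<in> I" "r \<in> carrier R" by (auto simp: K_def)
      show "a \<otimes> x \<in> K" if a: "a \<in> carrier R" for a
      proof -
        have "a \<otimes> x = a \<otimes> i \<oplus> (a \<otimes> r \<oplus> a \<otimes> r)"
          using x a I.a_Hcarr by (simp add: r_distr)
        moreover have "a \<otimes> i \<in> I" using lI a x(2) by (simp add: left_ideal_def)
        ultimately show ?thesis using a x(3) unfolding K_def by blast
      qed
      fix y assume "y \<in> K"
      then obtain i' r' where y: "y = i' \<oplus> (r' \<oplus> r')" "i' \<in> I" "r' \<in> carrier R" by (auto simp: K_def)
      have "x \<oplus> y = (i \<oplus> i') \<oplus> ((r \<oplus> r') \<oplus> (r \<oplus> r'))"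
        using x y I.a_Hcarr by (simp add: a_ac)
      moreover have "i \<oplus> i' \<in> I" "r \<oplus> r' \<in> carrier R" using x y by auto
      ultimately show "x \<oplus> y \<in> K" unfolding K_def by blast
    qed
    moreover have "\<one> \<oplus> \<one> \<in> K"
      unfolding K_def by (intro CollectI exI[of _ \<zero>] exI[of _ \<one>]) simp
    ultimately have "K = carrier R"
      using I IK t unfolding maximal_left_ideal_def by blast
    then obtain i r where ir: "\<one> = i \<oplus> (r \<oplus> r)" "i \<in> I" "r \<in> carrier R"
      using one_closed unfolding K_def by blast
    then have "\<one> \<oplus> (\<ominus> r \<oplus> \<ominus> r) = i \<oplus> (r \<oplus> r) \<oplus> (\<ominus> r \<oplus> \<ominus> r)" by simp
    also have "\<dots> = i"
      using ir(3) I.a_Hcarr[OF ir(2)] by algebra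
    finally have "i \<in> Units R"
      using Units_add_twice[OF fin nil Units_one_closed, of "\<ominus> r"] ir(3) by simp
    then show False
      using left_ideal_eq_carrier[OF lI ir(2)] I by (simp add: maximal_left_ideal_def)
  qed
  then show "\<one> \<oplus> \<one> \<in> jacobson_radical R"
    by (auto simp: jacobson_radical_def)
qed

text \<open>Multiples of 1 in the quotient are formed by coset addition alone, hence the setting of
  an additive subgroup. As 1 is outside \<open>J\<close>, the multiple with \<open>n = 1\<close> is
  nonzero, and only \<open>n = 2\<close> has to be tested.\<close>

lemma ring_characteristic_Quot_eq_2_iff:
  assumes "additive_subgroup J R" "\<one> \<notin> J"
  shows "ring_characteristic (R Quot J) = 2 \<longleftrightarrow> \<one> \<oplus> \<one> \<in> J"
proof -
  interpret J: abelian_subgroup J R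
    using assms(1) abelian_group_axioms abelian_subgroupI3 by blast
  have coset_eq: "J +> x = J \<longleftrightarrow> x \<in> J" if "x \<in> carrier R" for x
    using that J.a_rcos_const J.a_rcos_self by auto
  define P where "P n \<longleftrightarrow> 0 < n \<and> [n] \<cdot>\<^bsub>R Quot J\<^esub> \<one>\<^bsub>R Quot J\<^esub> = \<zero>\<^bsub>R Quot J\<^esub>" for n :: nat
  \<comment> \<open>A multiple of 1 unfolds to a sum that starts from the zero coset
    \<open>J\<close>; this equation absorbs that start.\<close>
  have J0: "J <+> (J +> \<one>) = J +> \<one>"
    using J.a_rcos_sum[of \<zero> \<one>] coset_eq[of \<zero>] J.zero_closed by simp
  have P1: "\<not> P 1"
    using coset_eq[of \<one>] assms(2) J0
    by (simp add: P_def add_pow_def FactRing_def nat_pow_def)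
  have P2: "P 2 \<longleftrightarrow> \<one> \<oplus> \<one> \<in> J"
    using coset_eq[of "\<one> \<oplus> \<one>"] J0 J.a_rcos_sum[of \<one> \<one>]
    by (simp add: P_def add_pow_def FactRing_def nat_pow_def numeral_2_eq_2)
  have "ring_characteristic (R Quot J) = (if \<exists>n. P n then LEAST n. P n else 0)"
    unfolding ring_characteristic_def P_def by (rule refl)
  also have "\<dots> = 2 \<longleftrightarrow> P 2"
  proof
    \<comment> \<open>The default value 0 differs from 2, so some \<open>n\<close> satisfies
      \<open>P\<close>, and the least one does.\<close>
    assume "(if \<exists>n. P n then LEAST n. P n else 0) = 2"
    then show "P 2" by (metis LeastI_ex zero_neq_numeral)
  next
    assume "P 2"
    moreover have "2 \<le> n" if "P n" for n
    proof -
      have "n \<noteq> 0" "n \<noteq> 1" using that P1 by (auto simp: P_def)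
      then show ?thesis by simp
    qed
    ultimately show "(if \<exists>n. P n then LEAST n. P n else 0) = 2"
      by (auto intro: Least_equality)
  qed
  finally show ?thesis using P2 by simp
qed

section \<open>Nilpotency of 2 from a comparison of maximal independent sets\<close>

lemma two_nilpotent_if_well_covered:
  assumes fin: "finite (carrier R)" and "\<one> \<noteq> \<zero>"
    and wc: "well_covered (unit_graph R)"
    and n: "0 < n" "(\<one> \<oplus> \<one>) [^] (n::nat) \<otimes> (\<one> \<oplus> \<one>) [^] n = (\<one> \<oplus> \<one>) [^] n"
  shows "(\<one> \<oplus> \<one>) [^] n = \<zero>"
proof (rule ccontr)
  let ?h = "(\<one> \<oplus> \<one>) [^] n"
  assume h0: "?h \<noteq> \<zero>"
  have hR: "?h \<in> carrier R" by simp
  obtain e where e: "local_idempotent R e" "?h \<otimes> e = e"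
    using local_idempotent_exists[OF fin hR n(2) h0] by blast
  let ?M = "local_left_ideal R e"
  have idx: "card (a_rcosets (local_left_ideal R e')) * card (local_left_ideal R e') = card (carrier R)"
    if "local_idempotent R e'" for e'
    using a_lagrange[OF fin additive_subgroup_local_left_ideal[OF that]] by (simp add: order_def)
  have card_eq: "card S = card ?M" if "maximal_independent_set (unit_graph R) S" for S
    using wc that maximal_independent_local_left_ideal[OF fin e(1)] unfolding well_covered_def by blast
  have odd: "odd (card (a_rcosets ?M))"
    using odd_index_local_left_ideal[OF fin e(1) n(1) e(2)] .
  show False
  proof (cases "?h = \<one>")
    case True
    then have two: "\<one> \<oplus> \<one> \<in> Units R"
      using Units_power_one[OF _ _ n(1)] by simp
    then obtain D where D: "unit_dominating R D" "even (card D)"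
      using even_unit_dominating_exists[OF ring_axioms fin] assms(2) by blast
    \<comment> \<open>Well-coveredness transfers the parity of \<open>D\<close> to
      \<open>?M\<close>, and Lagrange passes it on to \<open>R\<close>. The resulting element of
      additive order 2 contradicts invertibility of 2.\<close>
    then have "even (card ?M)"
      using card_eq[OF unit_dominating_maximal_independent] by metis
    then have "even (order (add_monoid R))"
      using idx[OF e(1)] by (metis dvd_mult order_def monoid.select_convs(1) partial_object.select_convs(1))
    then obtain x where x: "x \<in> carrier R" "x \<noteq> \<zero>" "x \<oplus> x = \<zero>"
      using group.even_order_iff_involution[OF a_group] fin by auto
    have "inv (\<one> \<oplus> \<one>) \<otimes> ((\<one> \<oplus> \<one>) \<otimes> x) = x"
      using two x(1) by (simp add: m_assoc[symmetric])
    then show False using x two by (simp add: two_mult)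
  next
    case False
    \<comment> \<open>A local idempotent below \<open>1 - h\<close> is annihilated by
      \<open>h\<close>, so its left ideal has even index, in contrast to \<open>?M\<close>.\<close>
    let ?g = "\<one> \<ominus> ?h"
    note g = complement_idempotent[OF hR n(2)]
    have "?g \<noteq> \<zero>" using False by simp
    then obtain e' where e': "local_idempotent R e'" "?g \<otimes> e' = e'"
      using local_idempotent_exists[OF fin g(1,2)] by blast
    have e'R: "e' \<in> carrier R" using e'(1) by (simp add: local_idempotent_def)
    have "?h \<otimes> e' = \<zero>"
      using e'(2) e'R hR g by (metis m_assoc l_null)
    then have even: "even (card (a_rcosets (local_left_ideal R e')))"
      using even_index_local_left_ideal[OF fin e'(1)] by blast
    have "card (local_left_ideal R e') = card ?M"
      using card_eq maximal_independent_local_left_ideal[OF fin e'(1)] by blast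
    moreover have "card (carrier R) \<noteq> 0" using fin one_closed by auto
    \<comment> \<open>By Lagrange, equal sizes give equal indices, which clashes with the
      parities.\<close>
    ultimately have "card (a_rcosets (local_left_ideal R e')) = card (a_rcosets ?M)"
      using idx[OF e(1)] idx[OF e'(1)] by (metis mult_cancel2 mult_0_right)
    then show False using odd even by simp
  qed
qed

end

theorem theorem2p10:
  fixes R :: "('a, 'm) ring_scheme"
  assumes "ring R"
    and "finite (carrier R)"
    and "\<one>\<^bsub>R\<^esub> \<noteq> \<zero>\<^bsub>R\<^esub>"
  shows "well_covered (unit_graph R) \<longleftrightarrow>
    well_covered (unitary_cayley_graph R) \<and>
    ring_characteristic (R Quot (jacobson_radical R)) = 2"
proof -
  interpret ring R by fact
  define t where "t = \<one>\<^bsub>R\<^esub> \<oplus>\<^bsub>R\<^esub> \<one>\<^bsub>R\<^esub>"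
  obtain n :: nat where n: "0 < n" "t [^]\<^bsub>R\<^esub> n \<otimes>\<^bsub>R\<^esub> t [^]\<^bsub>R\<^esub> n = t [^]\<^bsub>R\<^esub> n"
    using idempotent_power_exists[OF assms(2), of t] by (auto simp: t_def)
  have "ring_characteristic (R Quot (jacobson_radical R)) = 2 \<longleftrightarrow> t [^]\<^bsub>R\<^esub> n = \<zero>\<^bsub>R\<^esub>"
    using ring_characteristic_Quot_eq_2_iff[OF left_ideal_additive_subgroup[OF left_ideal_jacobson_radical]
        one_notin_jacobson_radical[OF assms(2,3)]]
      two_in_jacobson_radical_iff[OF assms(2) n[unfolded t_def]]
    by (simp add: t_def)
  moreover have "t [^]\<^bsub>R\<^esub> n = \<zero>\<^bsub>R\<^esub>" if "well_covered (unit_graph R)"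
    using two_nilpotent_if_well_covered[OF assms(2,3) that n[unfolded t_def]] by (simp add: t_def)
  moreover have "unit_graph R = unitary_cayley_graph R" if "t [^]\<^bsub>R\<^esub> n = \<zero>\<^bsub>R\<^esub>"
    using unit_graph_eq_unitary_cayley_graph[OF assms(2)] that by (simp add: t_def)
  \<comment> \<open>If the power of \<open>t\<close> vanishes, the graphs agree and the
    characteristic is 2; otherwise both sides of the equivalence fail.\<close>
  ultimately show ?thesis by auto
qed

end
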